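(* Let $X$ and $Y$ be two non-negative random variables with differentiable quantile functions $F^{-1}$ and $G^{-1}$ and density functions $f$ and $g$, respectively. Assume that the ratio $p\mapsto f(F^{-1}(p))/g(G^{-1}(p))$ on $(0,1)$ has $n$ modes (with $n\ge 1$ finite), located at $0<p_1<p_2<\cdots<p_n<1$, and that the ratio is initially increasing (so it is increasing on $(0,p_1)$, decreasing on $(p_1,p_2)$, and so on alternately, up to $(p_n,1)$). Define $$\delta(p)=F^{-1}(p)\,\frac{f(F^{-1}(p))}{g(G^{-1}(p))}-G^{-1}(p),\qquad p\in(0,1).$$ Then the number of modes of $p\mapsto G^{-1}(p)/F^{-1}(p)$ on $(0,1)$ is less than or equal to $n+1$. In particular, the number of modes depends on the following conditions: (i) there is a mode of $G^{-1}/F^{-1}$ in the interval $(0,p_1)$ if, and only if, $\lim_{p\to0^+}\delta(p)\,\delta(p_1)<0$; (ii) for each $i=1,\dots,n-1$, there is a mode of $G^{-1}/F^{-1}$ in the interval $(p_i,p_{i+1})$ if, and only if, $\delta(p_i)\,\delta(p_{i+1})<0$; (iii) there is a mode of $G^{-1}/F^{-1}$ in the interval $(p_n,1)$ if, and only if, $\lim_{p\to1^-}\delta(p)\,\delta(p_n)<0$.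
   Context: Standing assumptions: $X$ and $Y$ are non-negative, have finite expectation, distribution functions $F$ and $G$, density functions $f$ and $g$, and interval supports $(l_X,u_X)$ and $(l_Y,u_Y)$ (bounded or unbounded). The quantile function is $F^{-1}(p)=\inf\{x\in\mathbb R: F(x)\ge p\}$, $p\in(0,1)$, and similarly for $G^{-1}$; quantile functions are differentiable on $(0,1)$ with $\frac{d}{dp}F^{-1}(p)=1/f(F^{-1}(p))$ and $\frac{d}{dp}G^{-1}(p)=1/g(G^{-1}(p))$. "Increasing" and "decreasing" are used in the non-strict sense. A mode of a function means a relative extreme (maximum or minimum), i.e. a point at which the function changes from increasing to decreasing or from decreasing to increasing (a flat stretch at the extreme level counts as a single mode). Limits are taken in the extended reals. *)

theory Defs
  imports "HOL-Probability.Probability"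
begin

definition quantile :: "'a measure \<Rightarrow> ('a \<Rightarrow> real) \<Rightarrow> real \<Rightarrow> real" where
  "quantile M X p = Inf {x. cdf (distr M borel X) x \<ge> p}"

definition support :: "real measure \<Rightarrow> real set" where
  "support D = {x. \<forall>U. open U \<and> x \<in> U \<longrightarrow> measure D U > 0}"

text \<open>
  The topological support is closed, so ``interval support (l, u)'' is read as: the support is
  the closure of the open interval. The end points are extended reals because the interval may be
  unbounded. The condition that the density is positive at the quantiles is what makes the
  derivative 1 / f (quantile p) meaningful (recall that 1 / 0 = 0).
\<close>

locale quantile_rv = prob_space M
  for M :: "'a measure" +
  fixes X :: "'a \<Rightarrow> real" and f :: "real \<Rightarrow> real" and l u :: ereal
  assumes nonneg: "AE w in M. 0 \<le> X w"
    and finite_expectation: "integrable M X"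
    and density_nonneg: "\<And>x. 0 \<le> f x"
    and density: "distributed M lborel X (\<lambda>x. ennreal (f x))"
    and end_points: "l < u"
    and interval_support: "support (distr M borel X) = closure (einterval l u)"
    and density_pos: "\<And>p. p \<in> {0<..<1} \<Longrightarrow> 0 < f (quantile M X p)"
    and quantile_deriv: "\<And>p. p \<in> {0<..<1} \<Longrightarrow>
      (quantile M X has_real_derivative 1 / f (quantile M X p)) (at p)"

definition density_quantile_ratio ::
  "(real \<Rightarrow> real) \<Rightarrow> (real \<Rightarrow> real) \<Rightarrow> (real \<Rightarrow> real) \<Rightarrow> (real \<Rightarrow> real) \<Rightarrow> real \<Rightarrow> real" where
  "density_quantile_ratio Finv f Ginv g p = f (Finv p) / g (Ginv p)"

definition delta ::
  "(real \<Rightarrow> real) \<Rightarrow> (real \<Rightarrow> real) \<Rightarrow> (real \<Rightarrow> real) \<Rightarrow> (real \<Rightarrow> real) \<Rightarrow> real \<Rightarrow> real" where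
  "delta Finv f Ginv g p = Finv p * density_quantile_ratio Finv f Ginv g p - Ginv p"

text \<open>
  A mode of h on I is a maximal flat stretch {a..b}, with a = b for an isolated extreme point, at
  which h changes from increasing to decreasing or conversely. Representing a mode by the whole
  stretch makes a flat stretch count once. Monotonicity is non-strict, but h must really take
  lower (for a minimum: higher) values on both sides of the stretch; otherwise every point of a
  constant function would be a mode.
\<close>

definition is_max_mode :: "real set \<Rightarrow> (real \<Rightarrow> real) \<Rightarrow> real set \<Rightarrow> bool" where
  "is_max_mode I h S \<longleftrightarrow> (\<exists>a b c d. c < a \<and> a \<le> b \<and> b < d \<and> {c..d} \<subseteq> I \<and> S = {a..b} \<and>
     mono_on {c..a} h \<and> antimono_on {b..d} h \<and>
     (\<forall>x\<in>{a..b}. h x = h a) \<and> (\<forall>x\<in>{c..<a} \<union> {b<..d}. h x < h a))"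

definition is_min_mode :: "real set \<Rightarrow> (real \<Rightarrow> real) \<Rightarrow> real set \<Rightarrow> bool" where
  "is_min_mode I h S \<longleftrightarrow> is_max_mode I (\<lambda>x. - h x) S"

definition modes_on :: "real set \<Rightarrow> (real \<Rightarrow> real) \<Rightarrow> real set set" where
  "modes_on I h = {S. is_max_mode I h S \<or> is_min_mode I h S}"

definition has_mode_within :: "real set \<Rightarrow> (real \<Rightarrow> real) \<Rightarrow> real set \<Rightarrow> bool" where
  "has_mode_within I h J \<longleftrightarrow> (\<exists>S\<in>modes_on I h. S \<subseteq> J)"

text \<open>
  The function h has exactly n modes on (0,1), located at p 1 < ... < p n, and it is initially
  increasing. The conventions p 0 = 0 and p (n + 1) = 1 give the two outer intervals. When a
  mode is a flat stretch, its location is any one point of it.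
\<close>

definition alternating_modes :: "(real \<Rightarrow> real) \<Rightarrow> nat \<Rightarrow> (nat \<Rightarrow> real) \<Rightarrow> bool" where
  "alternating_modes h n p \<longleftrightarrow>
     p 0 = 0 \<and> p (Suc n) = 1 \<and> strict_mono_on {0..Suc n} p \<and>
     (\<exists>S. bij_betw S {1..n} (modes_on {0<..<1} h) \<and> (\<forall>i\<in>{1..n}. p i \<in> S i)) \<and>
     (\<forall>i\<le>n. if even i then mono_on {p i<..<p (Suc i)} h else antimono_on {p i<..<p (Suc i)} h)"

end

theory Submission
  imports Defs
begin

text \<open>
  Write A and B for the two quantile functions and r = B' / A' for the ratio. The derivative of
  B / A is \<delta> times a positive factor, so a mode of B / A is a maximal zero stretch of \<delta> across
  which \<delta> changes sign. If r increases on an interval, then so does \<delta>: by the Cauchy mean value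
  theorem, A x * (r y - r x) is at most \<delta> y - \<delta> x for x < y. Hence each interval between
  consecutive p i contains at most one mode, namely the zero set of \<delta> there, and it contains one
  exactly when \<delta> takes both signs. No mode of B / A contains a point p i: around p i the function
  \<delta> has a local extremum, and \<delta> cannot vanish on all of {p i..p (i + 1)}, since r would then be
  constant there and p i and p (i + 1) would lie in the same mode of r.
\<close>

section \<open>Modes as maximal flat stretches\<close>

text \<open>Keeps only what maxima and minima share, so that the next two lemmas need no distinction
  between them.\<close>

lemma mode_flat_maximal:
  assumes "S \<in> modes_on I h"
  obtains a b c d where "c < a" "a \<le> b" "b < d" "S = {a..b}" "\<forall>x\<in>{a..b}. h x = h a"
    "\<forall>x\<in>{c..<a} \<union> {b<..d}. h x \<noteq> h a"
proof -
  have "is_max_mode I h S \<or> is_max_mode I (\<lambda>x. - h x) S"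
    using assms by (auto simp: modes_on_def is_min_mode_def)
  then have "\<exists>a b c d. c < a \<and> a \<le> b \<and> b < d \<and> S = {a..b} \<and> (\<forall>x\<in>{a..b}. h x = h a) \<and>
    (\<forall>x\<in>{c..<a} \<union> {b<..d}. h x \<noteq> h a)"
  proof
    assume "is_max_mode I h S"
    then show ?thesis
      unfolding is_max_mode_def by (metis less_irrefl)
  next
    assume "is_max_mode I (\<lambda>x. - h x) S"
    then show ?thesis
      unfolding is_max_mode_def by (metis less_irrefl neg_equal_iff_equal)
  qed
  then show thesis
    using that by blast
qed

text \<open>An interval that meets \<open>S\<close> and leaves it must pass through
  \<open>{c..<a}\<close> or \<open>{b<..d}\<close>, where \<open>h\<close> differs from its value on
  \<open>S\<close>.\<close>

lemma flat_interval_subset_mode: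
  assumes "S \<in> modes_on I h" "x \<in> S" "x \<in> T" "is_interval T" "\<And>y. y \<in> T \<Longrightarrow> h y = h x"
  shows "T \<subseteq> S"
proof
  fix y assume y: "y \<in> T"
  obtain a b c d where *: "c < a" "a \<le> b" "b < d" "S = {a..b}"
    and flat: "\<forall>x\<in>{a..b}. h x = h a"
    and maximal: "\<forall>x\<in>{c..<a} \<union> {b<..d}. h x \<noteq> h a"
    by (rule mode_flat_maximal[OF assms(1)])
  have between: "z \<in> T" if "min x y \<le> z" "z \<le> max x y" for z
    using mem_is_interval_1_I[OF assms(4,3) y, of z] mem_is_interval_1_I[OF assms(4) y assms(3), of z] that
    by (cases "x \<le> y") simp_all
  have x: "a \<le> x" "x \<le> b"
    using assms(2) * by auto
  show "y \<in> S"
  proof (rule ccontr)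
    assume "y \<notin> S"
    then consider "y < a" | "b < y"
      using * by force
    then show False
    proof cases
      case 1
      \<comment> \<open>The point \<open>y\<close> may lie below \<open>c\<close>. Clamping it at
        \<open>c\<close> keeps it between \<open>y\<close> and \<open>x\<close>, hence in
        \<open>T\<close>, and puts it next to the stretch.\<close>
      then have "max y c \<in> T" "max y c \<in> {c..<a} \<union> {b<..d}"
        using x * by (auto intro!: between)
      then show False
        using bspec[OF flat, of x] bspec[OF maximal, of "max y c"] assms(5) x by auto
    next
      case 2
      then have "min y d \<in> T" "min y d \<in> {c..<a} \<union> {b<..d}"
        using x * by (auto intro!: between)
      then show False
        using bspec[OF flat, of x] bspec[OF maximal, of "min y d"] assms(5) x by auto
    qed
  qed
qed

text \<open>Each of the two modes is a flat interval that meets the other, so each contains the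
  other.\<close>

lemma modes_disjoint:
  assumes "S \<in> modes_on I h" "S' \<in> modes_on I h" "x \<in> S" "x \<in> S'"
  shows "S = S'"
proof -
  have "T \<subseteq> T'" if T: "T \<in> modes_on I h" "T' \<in> modes_on I h" "x \<in> T" "x \<in> T'" for T T'
  proof -
    obtain a b where ab: "T = {a..b}" and flat: "\<forall>x\<in>{a..b}. h x = h a"
      by (rule mode_flat_maximal[OF T(1)])
    show ?thesis
    proof (rule flat_interval_subset_mode[OF T(2,4,3)])
      show "is_interval T"
        by (simp add: ab)
      show "h y = h x" if "y \<in> T" for y
        using bspec[OF flat, of x] bspec[OF flat, of y] T(3) that ab by simp
    qed
  qed
  then show ?thesis
    using assms by blast
qed

section \<open>One-sided limits of monotone functions in the extended reals\<close>

text \<open>The limit is the supremum over the open interval and is at least \<open>d p\<close>. So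
  the product can only be negative as \<open>d p < 0 < L\<close>, and \<open>0 < L\<close> means
  that some value is positive.\<close>

lemma mono_at_left_limit:
  fixes d :: "real \<Rightarrow> real"
  assumes "p < u" and mono: "mono_on {p..<u} d"
  shows "\<exists>L :: ereal. ((\<lambda>t. ereal (d t)) \<longlongrightarrow> L) (at_left u) \<and>
    (L * ereal (d p) < 0 \<longleftrightarrow> d p < 0 \<and> (\<exists>x\<in>{p<..<u}. 0 < d x))"
proof -
  define L where "L = (SUP x\<in>{p<..<u}. ereal (d x))"
  have ev: "\<forall>\<^sub>F x in at_left u. x \<in> {q<..<u}" if "q < u" for q
    using that by (rule eventually_at_left_real)
  have "((\<lambda>t. ereal (d t)) \<longlongrightarrow> L) (at_left u)"
  proof (rule increasing_tendsto)
    show "\<forall>\<^sub>F x in at_left u. ereal (d x) \<le> L"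
      using ev[OF \<open>p < u\<close>] by eventually_elim (auto simp: L_def intro: SUP_upper)
    fix c assume "c < L"
    then obtain y where y: "y \<in> {p<..<u}" "c < ereal (d y)"
      unfolding L_def less_SUP_iff by blast
    then have "\<forall>\<^sub>F x in at_left u. x \<in> {y<..<u}"
      by (intro ev) auto
    then show "\<forall>\<^sub>F x in at_left u. c < ereal (d x)"
    proof eventually_elim
      case (elim x)
      then have "d y \<le> d x"
        using y by (intro mono_onD[OF mono]) auto
      then show ?case
        using y(2) by (meson ereal_less_eq(3) less_le_trans)
    qed
  qed
  moreover have pos: "0 < L \<longleftrightarrow> (\<exists>x\<in>{p<..<u}. 0 < d x)"
    unfolding L_def less_SUP_iff by simp
  \<comment> \<open>The supremum does not range over \<open>p\<close> itself, so the midpoint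
    mediates.\<close>
  moreover have "ereal (d p) \<le> L"
  proof -
    have "d p \<le> d ((p + u) / 2)"
      using \<open>p < u\<close> by (intro mono_onD[OF mono]) auto
    then show ?thesis
      unfolding L_def using \<open>p < u\<close> by (intro SUP_upper2[of "(p + u) / 2"]) auto
  qed
  then have "L * ereal (d p) < 0 \<longleftrightarrow> d p < 0 \<and> 0 < L"
    by (cases L) (auto simp: mult_less_0_iff zero_ereal_def)
  ultimately show ?thesis
    by auto
qed

text \<open>The point reflection of the graph, \<open>- d (- x)\<close>, is again increasing and
  exchanges left and right.\<close>

lemma mono_at_right_limit:
  fixes d :: "real \<Rightarrow> real"
  assumes "l < p" and mono: "mono_on {l<..p} d"
  shows "\<exists>L :: ereal. ((\<lambda>t. ereal (d t)) \<longlongrightarrow> L) (at_right l) \<and>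
    (L * ereal (d p) < 0 \<longleftrightarrow> 0 < d p \<and> (\<exists>x\<in>{l<..<p}. d x < 0))"
proof -
  have "mono_on {- p..<- l} (\<lambda>x. - d (- x))"
    using mono by (auto simp: monotone_on_def)
  from mono_at_left_limit[OF _ this] \<open>l < p\<close> obtain L :: ereal where
    L: "((\<lambda>t. ereal (- d (- t))) \<longlongrightarrow> L) (at_left (- l))"
    and iff: "L * ereal (- d p) < 0 \<longleftrightarrow> - d p < 0 \<and> (\<exists>x\<in>{- p<..<- l}. 0 < - d (- x))"
    by auto
  have "((\<lambda>t. ereal (d t)) \<longlongrightarrow> - L) (at_right l)"
    using tendsto_uminus_ereal[OF L] by (simp add: at_left_minus filterlim_filtermap)
  moreover have "(\<exists>x\<in>{- p<..<- l}. 0 < - d (- x)) \<longleftrightarrow> (\<exists>x\<in>{l<..<p}. d x < 0)"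
    by (metis add.inverse_inverse greaterThanLessThan_iff minus_less_iff less_minus_iff neg_0_less_iff_less)
  moreover have "- L * ereal (d p) = L * ereal (- d p)"
    by (cases L) auto
  ultimately show ?thesis
    using iff by (intro exI[of _ "- L"]) auto
qed

section \<open>Modes of a function and the sign of its derivative\<close>

text \<open>The function \<open>d\<close> carries the sign of the derivative of \<open>h\<close>,
  and \<open>k\<close> is a positive weight. Neither is assumed continuous, so mean value arguments
  take the place of continuity.\<close>

locale derivative_sign =
  fixes l u :: real and h k d :: "real \<Rightarrow> real"
  assumes h_deriv: "x \<in> {l<..<u} \<Longrightarrow> (h has_real_derivative k x * d x) (at x)"
    and k_pos: "x \<in> {l<..<u} \<Longrightarrow> 0 < k x"
begin

lemma uminus: "derivative_sign l u (\<lambda>x. - h x) k (\<lambda>x. - d x)"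
  using k_pos by unfold_locales (auto intro!: derivative_eq_intros h_deriv)

lemma mean_value:
  assumes "x \<in> {l<..<u}" "y \<in> {l<..<u}" "x < y"
  obtains z where "x < z" "z < y" "h y - h x = (y - x) * k z * d z" "0 < (y - x) * k z"
proof -
  have "\<exists>z. x < z \<and> z < y \<and> h y - h x = (y - x) * (k z * d z)"
    using assms by (intro MVT2 h_deriv) auto
  then show thesis
    using that assms k_pos by (auto simp: mult.assoc)
qed

lemma pos_between:
  assumes "x \<in> {l<..<u}" "y \<in> {l<..<u}" "x < y" "h x < h y"
  shows "\<exists>z\<in>{x<..<y}. 0 < d z"
proof -
  obtain z where z: "x < z" "z < y" "h y - h x = (y - x) * k z * d z" "0 < (y - x) * k z"
    using mean_value[OF assms(1-3)] by blast
  then have "0 < d z"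
    using assms(4) zero_less_mult_pos[of "(y - x) * k z" "d z"] by simp
  then show ?thesis
    using z by auto
qed

lemma neg_between:
  assumes "x \<in> {l<..<u}" "y \<in> {l<..<u}" "x < y" "h y < h x"
  shows "\<exists>z\<in>{x<..<y}. d z < 0"
  using derivative_sign.pos_between[OF uminus, of x y] assms by auto

lemma h_mono_on:
  assumes "is_interval T" "T \<subseteq> {l<..<u}" "\<And>x. x \<in> T \<Longrightarrow> 0 \<le> d x"
  shows "mono_on T h"
proof (intro mono_onI leI notI)
  fix x y assume *: "x \<in> T" "y \<in> T" "x \<le> y" "h y < h x"
  then have "x < y"
    by (cases "x = y") auto
  then obtain z where "z \<in> {x<..<y}" "d z < 0"
    using neg_between[of x y] * assms(2) by blast
  moreover have "z \<in> T" if "z \<in> {x<..<y}" for z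
    using assms(1) * that unfolding is_interval_1 by (meson greaterThanLessThan_iff less_imp_le)
  ultimately show False
    using assms(3) by force
qed

lemma h_antimono_on:
  assumes "is_interval T" "T \<subseteq> {l<..<u}" "\<And>x. x \<in> T \<Longrightarrow> d x \<le> 0"
  shows "antimono_on T h"
  using derivative_sign.h_mono_on[OF uminus assms(1,2)] assms(3) by (auto simp: monotone_on_def)

text \<open>A substitute for continuity of \<open>d\<close>, in the manner of Darboux:
  \<open>h\<close> rises immediately to the right of \<open>x\<close>, and the mean value theorem
  turns this rise into a positive value of \<open>d\<close> nearby.\<close>

lemma pos_right:
  assumes "x \<in> {l<..<u}" "0 < d x" "x < y"
  shows "\<exists>z\<in>{x<..<y} \<inter> {l<..<u}. 0 < d z"
proof -
  obtain e where e: "e > 0" "\<And>t. 0 < t \<Longrightarrow> t < e \<Longrightarrow> h x < h (x + t)"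
    using DERIV_pos_inc_right[OF h_deriv[OF assms(1)]] k_pos[OF assms(1)] assms(2) by auto
  \<comment> \<open>Halving makes all three bounds strict: \<open>t < e\<close>,
    \<open>x + t < y\<close> and \<open>x + t < u\<close>.\<close>
  define t where "t = min e (min (y - x) (u - x)) / 2"
  have t: "0 < t" "t < e" "x + t < y" "x + t < u"
    using assms e(1) by (auto simp: t_def min_def field_simps)
  then have "\<exists>z\<in>{x<..<x + t}. 0 < d z"
    using assms e(2)[of t] by (intro pos_between) auto
  then show ?thesis
    using t assms by force
qed

lemma pos_left:
  assumes "x \<in> {l<..<u}" "0 < d x" "y < x"
  shows "\<exists>z\<in>{y<..<x} \<inter> {l<..<u}. 0 < d z"
proof -
  interpret reflected: derivative_sign "- u" "- l" "\<lambda>x. - h (- x)" "\<lambda>x. k (- x)" "\<lambda>x. d (- x)"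
    using k_pos by unfold_locales (auto intro!: derivative_eq_intros DERIV_chain2[OF h_deriv])
  obtain z where "z \<in> {- x<..<- y} \<inter> {- u<..<- l}" "0 < d (- z)"
    using reflected.pos_right[of "- x" "- y"] assms by fastforce
  then show ?thesis
    by (intro bexI[of _ "- z"]) auto
qed

lemma neg_right:
  assumes "x \<in> {l<..<u}" "d x < 0" "x < y"
  shows "\<exists>z\<in>{x<..<y} \<inter> {l<..<u}. d z < 0"
  using derivative_sign.pos_right[OF uminus, of x y] assms by auto

lemma neg_left:
  assumes "x \<in> {l<..<u}" "d x < 0" "y < x"
  shows "\<exists>z\<in>{y<..<x} \<inter> {l<..<u}. d z < 0"
  using derivative_sign.pos_left[OF uminus, of x y] assms by auto

text \<open>Fermat's criterion gives the zeros on the stretch; the strict drop of \<open>h\<close>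
  on both sides gives values of each sign arbitrarily close to it. The quantifiers admit
  \<open>x = l\<close> and \<open>x = u\<close> because the intervals considered later may end
  there.\<close>

lemma max_mode_crossing:
  assumes "is_max_mode {l<..<u} h S"
  obtains a b where "S = {a..b}" "a \<le> b" "l < a" "b < u" "\<forall>x\<in>{a..b}. d x = 0"
    "\<forall>x\<in>{l..<a}. \<exists>y\<in>{x<..<a}. 0 < d y"
    "\<forall>x\<in>{b<..u}. \<exists>y\<in>{b<..<x}. d y < 0"
proof -
  obtain a b c e where *: "c < a" "a \<le> b" "b < e" "{c..e} \<subseteq> {l<..<u}" "S = {a..b}"
    and eq: "\<And>x. x \<in> {a..b} \<Longrightarrow> h x = h a"
    and less: "\<And>x. x \<in> {c..<a} \<union> {b<..e} \<Longrightarrow> h x < h a"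
    using assms unfolding is_max_mode_def by blast
  have "c \<in> {l<..<u}" "e \<in> {l<..<u}"
    using *(1-4) by (intro subsetD[OF *(4)]; simp)+
  then have bounds: "l < c" "e < u" "l < a" "a < u" "l < b" "b < u"
    using * by auto
  have max: "h x \<le> h a" if "c \<le> x" "x \<le> e" for x
    using eq[of x] less[of x] that by (cases "x \<in> {a..b}") auto
  show thesis
  proof (rule that[of a b]; (intro ballI)?)
    fix x assume x: "x \<in> {a..b}"
    have "k x * d x = 0"
    proof (rule DERIV_local_max[OF h_deriv])
      show "x \<in> {l<..<u}" "0 < min (x - c) (e - x)"
        using x bounds * by auto
      show "\<forall>y. \<bar>x - y\<bar> < min (x - c) (e - x) \<longrightarrow> h y \<le> h x"
        using eq[OF x] max by auto
    qed
    then show "d x = 0"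
      using k_pos[of x] x bounds by auto
  next
    fix x assume "x \<in> {l..<a}"
    then have x: "l \<le> x" "x < a"
      by auto
    have "max c ((x + a) / 2) \<in> {c..<a}" 
      using x * by (auto simp: max_def field_simps)
    then have "\<exists>y\<in>{max c ((x + a) / 2)<..<a}. 0 < d y"
      using x bounds less by (intro pos_between) auto
    then show "\<exists>y\<in>{x<..<a}. 0 < d y"
      using x by (auto intro: less_trans)
  next
    fix x assume "x \<in> {b<..u}"
    then have x: "b < x" "x \<le> u"
      by auto
    have "min e ((x + b) / 2) \<in> {b<..e}"
      using x * by (auto simp: min_def field_simps)
    then have "\<exists>y\<in>{b<..<min e ((x + b) / 2)}. d y < 0"
      using x bounds less eq[of b] * by (intro neg_between) auto
    then show "\<exists>y\<in>{b<..<x}. d y < 0"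
      using x by force
  qed (use * bounds in auto)
qed

text \<open>The sign \<open>s\<close> is 1 for a maximum and -1 for a minimum, which lets one
  argument serve both.\<close>

lemma mode_crossing:
  assumes "S \<in> modes_on {l<..<u} h"
  obtains a b s where "S = {a..b}" "a \<le> b" "l < a" "b < u" "s = 1 \<or> s = (- 1 :: real)"
    "\<forall>x\<in>{a..b}. d x = 0"
    "\<forall>x\<in>{l..<a}. \<exists>y\<in>{x<..<a}. 0 < s * d y"
    "\<forall>x\<in>{b<..u}. \<exists>y\<in>{b<..<x}. s * d y < 0"
proof -
  consider "is_max_mode {l<..<u} h S" | "is_max_mode {l<..<u} (\<lambda>x. - h x) S"
    using assms by (auto simp: modes_on_def is_min_mode_def)
  then show thesis
  proof cases
    case 1
    show thesis
      by (rule max_mode_crossing[OF 1], rule that[of _ _ 1]) auto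
  next
    case 2
    show thesis
      by (rule derivative_sign.max_mode_crossing[OF uminus 2], rule that[of _ _ "- 1"]) auto
  qed
qed

text \<open>This yields uniqueness: a mode inside an interval where \<open>d\<close> is monotone is
  determined by that interval.\<close>

lemma mode_eq_zero_set:
  assumes "S \<in> modes_on {l<..<u} h" "S \<subseteq> {v<..<w}" "l \<le> v" "w \<le> u"
    and mono: "mono_on {v<..<w} d \<or> antimono_on {v<..<w} d"
  shows "S = {x \<in> {v<..<w}. d x = 0}"
proof -
  obtain a b s where S: "S = {a..b}" "a \<le> b" "l < a" "b < u" "s = 1 \<or> s = (- 1 :: real)"
    and zero: "\<forall>x\<in>{a..b}. d x = 0"
    and left: "\<forall>x\<in>{l..<a}. \<exists>y\<in>{x<..<a}. 0 < s * d y"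
    and right: "\<forall>x\<in>{b<..u}. \<exists>y\<in>{b<..<x}. s * d y < 0"
    by (rule mode_crossing[OF assms(1)])
  have ab: "v < a" "b < w"
    using S(1,2) assms(2) by auto
  \<comment> \<open>Near the mode, \<open>s * d\<close> is positive on the left and negative on the
    right, so of the two kinds of monotonicity it must be the decreasing one.\<close>
  have anti: "s * d y \<le> s * d x" if xy: "v < x" "x \<le> y" "y < w" for x y
  proof -
    obtain y1 where y1: "y1 \<in> {v<..<a}" "0 < s * d y1"
      using bspec[OF left, of v] ab assms by auto
    obtain y2 where y2: "y2 \<in> {b<..<w}" "s * d y2 < 0"
      using bspec[OF right, of w] ab assms by auto
    have "y1 \<in> {v<..<w}" "y2 \<in> {v<..<w}" "y1 \<le> y2" "x \<in> {v<..<w}" "y \<in> {v<..<w}"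
      using y1 y2 ab S(2) xy by auto
    then show ?thesis
      using mono S(5) y1(2) y2(2) xy(2) unfolding monotone_on_def by fastforce
  qed
  have "x \<in> {a..b}" if x: "v < x" "x < w" "d x = 0" for x
  proof (rule ccontr)
    assume "x \<notin> {a..b}"
    then consider "x < a" | "b < x"
      by force
    then show False
    proof cases
      case 1
      then obtain y where "y \<in> {x<..<a}" "0 < s * d y"
        using bspec[OF left, of x] x assms by auto
      then show False
        using anti[of x y] x ab S(2) by auto
    next
      case 2
      then obtain y where "y \<in> {b<..<x}" "s * d y < 0"
        using bspec[OF right, of x] x assms by auto
      then show False
        using anti[of y x] x ab S(2) by auto
    qed
  qed
  then have "{x \<in> {v<..<w}. d x = 0} \<subseteq> S"
    unfolding S(1) by (auto simp del: atLeastAtMost_iff)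
  moreover have "S \<subseteq> {x \<in> {v<..<w}. d x = 0}"
    using assms(2) zero unfolding S(1) by blast
  ultimately show ?thesis
    by blast
qed

text \<open>The mode consists of the minimisers of \<open>h\<close> on \<open>{x..y}\<close>. They
  are interior because \<open>h\<close> falls just after \<open>x\<close> and rises just before
  \<open>y\<close>.\<close>

lemma min_mode_if_sign_change:
  assumes "l \<le> v" "w \<le> u" and mono: "mono_on {v<..<w} d"
    and "x \<in> {v<..<w}" "d x < 0" "y \<in> {v<..<w}" "0 < d y"
  shows "\<exists>S. is_min_mode {l<..<u} h S \<and> S \<subseteq> {v<..<w}"
proof -
  have le: "d s \<le> d t" if "x \<le> s" "s \<le> t" "t \<le> y" for s t
    using that assms by (intro mono_onD[OF mono]) auto
  have "x < y"
    using mono_onD[OF mono, of y x] assms by force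
  have xy: "{x..y} \<subseteq> {l<..<u}"
    using assms by auto
  have cont: "continuous_on {x..y} h"
    using xy h_deriv by (intro continuous_at_imp_continuous_on ballI DERIV_isCont[OF h_deriv]) auto
  then obtain m where m: "m \<in> {x..y}" "\<And>t. t \<in> {x..y} \<Longrightarrow> h m \<le> h t"
    using continuous_attains_inf[of "{x..y}" h] \<open>x < y\<close> by auto
  \<comment> \<open>The set of minimisers is compact, so it has a least element \<open>a\<close> and
    a greatest element \<open>b\<close>, the ends of the mode.\<close>
  define S where "S = {t \<in> {x..y}. h t = h m}"
  have "closed S"
    unfolding S_def by (intro continuous_closed_preimage_constant cont) auto
  moreover have "bounded S"
    by (rule bounded_subset[of "{x..y}"]) (auto simp: S_def)
  ultimately have "compact S"
    by (simp add: compact_eq_bounded_closed)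
  moreover have "S \<noteq> {}"
    using m(1) by (auto simp: S_def)
  ultimately obtain a b where a: "a \<in> S" "\<And>t. t \<in> S \<Longrightarrow> a \<le> t" and b: "b \<in> S" "\<And>t. t \<in> S \<Longrightarrow> t \<le> b"
    using compact_attains_inf[of S] compact_attains_sup[of S] by metis
  have inner: "x < t \<and> t < y \<and> d t = 0" if "t \<in> S" for t
  proof -
    have t: "x \<le> t" "t \<le> y" "h t = h m"
      using that by (auto simp: S_def)
    then have tlu: "t \<in> {l<..<u}"
      using xy by auto
    have "\<not> d t < 0" if "t < y"
    proof
      assume "d t < 0"
      then obtain e where e: "e > 0" "\<And>s. 0 < s \<Longrightarrow> s < e \<Longrightarrow> h (t + s) < h t"
        using DERIV_neg_dec_right[OF h_deriv[OF tlu]] k_pos[OF tlu] t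
        by (auto simp: mult_pos_neg)
      define s where "s = min e (y - t) / 2"
      have "0 < s" "s < e" "t + s \<in> {x..y}"
        using that e(1) t by (auto simp: s_def min_def field_simps)
      then show False
        using m(2)[of "t + s"] e(2)[of s] t by auto
    qed
    moreover have "\<not> 0 < d t" if "x < t"
    proof
      assume "0 < d t"
      then obtain e where e: "e > 0" "\<And>s. 0 < s \<Longrightarrow> s < e \<Longrightarrow> h (t - s) < h t"
        using DERIV_pos_inc_left[OF h_deriv[OF tlu]] k_pos[OF tlu] t
        by auto
      define s where "s = min e (t - x) / 2"
      have "0 < s" "s < e" "t - s \<in> {x..y}"
        using that e(1) t by (auto simp: s_def min_def field_simps)
      then show False
        using m(2)[of "t - s"] e(2)[of s] t by auto
    qed
    ultimately show ?thesis
      using t assms(5,7) \<open>x < y\<close> by (cases "t = x"; cases "t = y") auto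
  qed
  have ab: "x < a" "a \<le> b" "b < y" "d a = 0" "d b = 0" "h a = h m" "h b = h m"
    using inner[OF a(1)] inner[OF b(1)] a b(1) by (auto simp: S_def)
  \<comment> \<open>Monotonicity squeezes \<open>d\<close> between its zeros at \<open>a\<close> and
    \<open>b\<close>, so no gap can occur among the minimisers.\<close>
  have zero: "d t = 0" if "t \<in> {a..b}" for t
    using le[of a t] le[of t b] ab that by auto
  have const: "h t = h a" if "t \<in> {a..b}" for t
  proof -
    have "mono_on {a..b} h"
      using zero ab xy by (intro h_mono_on) auto
    then have "h a \<le> h t" "h t \<le> h b"
      using that by (auto simp: monotone_on_def)
    then show ?thesis
      using ab by simp
  qed
  have "antimono_on {x..a} h"
    using le[of _ a] ab xy by (intro h_antimono_on) auto
  moreover have "mono_on {b..y} h"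
    using le[of b] ab xy by (intro h_mono_on) auto
  moreover have "h a < h t" if t: "t \<in> {x..<a} \<union> {b<..y}" for t
  proof -
    have "t \<in> {x..y}" "t \<notin> S"
      using t a(2) b(2) ab by force+
    then show ?thesis
      using m(2)[of t] ab by (auto simp: S_def)
  qed
  ultimately have *: "mono_on {x..a} (\<lambda>x. - h x)" "antimono_on {b..y} (\<lambda>x. - h x)"
    "\<forall>t\<in>{x..<a} \<union> {b<..y}. - h t < - h a"
    by (simp_all add: monotone_on_def)
  have "\<forall>t\<in>{a..b}. - h t = - h a"
    using const by (metis (no_types))
  then have "is_min_mode {l<..<u} h {a..b}"
    unfolding is_min_mode_def is_max_mode_def
    by (rule_tac exI[of _ a], rule_tac exI[of _ b], rule_tac exI[of _ x], rule_tac exI[of _ y])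
      (intro conjI ab(1-3) xy * refl)
  then show ?thesis
    using ab assms by (intro exI[of _ "{a..b}"]) auto
qed

lemma has_mode_within_iff:
  assumes "l \<le> v" "w \<le> u" and mono: "mono_on {v<..<w} d \<or> antimono_on {v<..<w} d"
  shows "has_mode_within {l<..<u} h {v<..<w} \<longleftrightarrow>
    (\<exists>x\<in>{v<..<w}. d x < 0) \<and> (\<exists>y\<in>{v<..<w}. 0 < d y)"
proof
  assume "has_mode_within {l<..<u} h {v<..<w}"
  then obtain S where S: "S \<in> modes_on {l<..<u} h" "S \<subseteq> {v<..<w}"
    by (auto simp: has_mode_within_def)
  obtain a b s where ab: "S = {a..b}" "a \<le> b" "l < a" "b < u" "s = 1 \<or> s = (- 1 :: real)"
    and "\<forall>x\<in>{a..b}. d x = 0"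
    and left: "\<forall>x\<in>{l..<a}. \<exists>y\<in>{x<..<a}. 0 < s * d y"
    and right: "\<forall>x\<in>{b<..u}. \<exists>y\<in>{b<..<x}. s * d y < 0"
    by (rule mode_crossing[OF S(1)])
  have bounds: "v < a" "b < w"
    using ab S(2) by auto
  obtain y where "y \<in> {v<..<a}" "0 < s * d y"
    using bspec[OF left, of v] bounds assms by auto
  moreover obtain z where "z \<in> {b<..<w}" "s * d z < 0"
    using bspec[OF right, of w] bounds assms by auto
  ultimately have "y \<in> {v<..<w}" "z \<in> {v<..<w}" "d y < 0 \<and> 0 < d z \<or> d z < 0 \<and> 0 < d y"
    using bounds ab by auto
  then show "(\<exists>x\<in>{v<..<w}. d x < 0) \<and> (\<exists>y\<in>{v<..<w}. 0 < d y)"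
    by blast
next
  assume "(\<exists>x\<in>{v<..<w}. d x < 0) \<and> (\<exists>y\<in>{v<..<w}. 0 < d y)"
  then obtain x y where xy: "x \<in> {v<..<w}" "d x < 0" "y \<in> {v<..<w}" "0 < d y"
    by blast
  from mono show "has_mode_within {l<..<u} h {v<..<w}"
  proof
    assume "mono_on {v<..<w} d"
    from min_mode_if_sign_change[OF assms(1,2) this xy] show ?thesis
      by (auto simp: has_mode_within_def modes_on_def)
  next
    \<comment> \<open>For decreasing \<open>d\<close>, a minimum mode of \<open>- h\<close> is
      sought; it is a maximum mode of \<open>h\<close>.\<close>
    assume "antimono_on {v<..<w} d"
    then have "mono_on {v<..<w} (\<lambda>x. - d x)"
      by (auto simp: monotone_on_def)
    from derivative_sign.min_mode_if_sign_change[OF uminus assms(1,2) this xy(3) _ xy(1)] xy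
    show ?thesis
      by (auto simp: has_mode_within_def modes_on_def is_min_mode_def)
  qed
qed

end

section \<open>Quotients of two functions and the ratio of their derivatives\<close>

text \<open>To be instantiated with \<open>A\<close> and \<open>B\<close> the quantile functions of
  X and Y, \<open>a\<close> the derivative of \<open>A\<close>, and \<open>r\<close> the
  density-quantile ratio, which is then the derivative of \<open>B\<close> relative to that of
  \<open>A\<close>.\<close>

locale quotient_pair =
  fixes A B a r :: "real \<Rightarrow> real"
  assumes A_pos: "x \<in> {0<..<1} \<Longrightarrow> 0 < A x"
    and A_deriv: "x \<in> {0<..<1} \<Longrightarrow> (A has_real_derivative a x) (at x)"
    and a_pos: "x \<in> {0<..<1} \<Longrightarrow> 0 < a x"
    and B_deriv: "x \<in> {0<..<1} \<Longrightarrow> (B has_real_derivative r x * a x) (at x)"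
begin

text \<open>The abstract form of \<delta>: the numerator of the quotient rule for
  \<open>B / A\<close>, divided by \<open>a x\<close>.\<close>

definition "dev x = A x * r x - B x"

lemma uminus: "quotient_pair A (\<lambda>x. - B x) a (\<lambda>x. - r x)"
  using A_pos A_deriv a_pos by unfold_locales (auto intro!: derivative_eq_intros B_deriv)

lemma dev_uminus: "quotient_pair.dev A (\<lambda>x. - B x) (\<lambda>x. - r x) x = - dev x"
  unfolding quotient_pair.dev_def[OF uminus] dev_def by simp

lemma derivative_sign_quotient: "derivative_sign 0 1 (\<lambda>x. B x / A x) (\<lambda>x. a x / (A x)\<^sup>2) dev"
proof
  fix x :: real assume x: "x \<in> {0<..<1}"
  show "((\<lambda>x. B x / A x) has_real_derivative a x / (A x)\<^sup>2 * dev x) (at x)"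
    using A_pos[OF x]
    by (auto intro!: derivative_eq_intros A_deriv[OF x] B_deriv[OF x]
        simp: dev_def field_simps power2_eq_square)
  show "0 < a x / (A x)\<^sup>2"
    using A_pos[OF x] a_pos[OF x] by simp
qed

text \<open>Comparing \<open>r\<close> with a constant \<open>K\<close> becomes a question about the
  sign of a derivative, so the sign lemmas above apply to \<open>r\<close> without
  continuity.\<close>

lemma derivative_sign_shift: "derivative_sign 0 1 (\<lambda>x. B x - K * A x) a (\<lambda>x. r x - K)"
  by unfold_locales (auto intro!: derivative_eq_intros A_deriv B_deriv a_pos simp: algebra_simps)

text \<open>The ratio r is a derivative with respect to A, hence has no jump at the end points.\<close>

lemma r_mono_on_closed:
  assumes "0 \<le> v" "w \<le> 1" and mono: "mono_on {v<..<w} r"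
  shows "mono_on ({v..w} \<inter> {0<..<1}) r"
proof (intro mono_onI)
  have left: "r v \<le> r x" if x: "v < x" "x < w" "0 < v" for x
  proof (rule ccontr)
    assume "\<not> r v \<le> r x"
    then obtain z where "z \<in> {v<..<x}" "r x < r z"
      using derivative_sign.pos_right[OF derivative_sign_shift, of v "r x" x] x assms by auto
    then show False
      using mono_onD[OF mono, of z x] x by auto
  qed
  have right: "r x \<le> r w" if x: "v < x" "x < w" "w < 1" for x
  proof (rule ccontr)
    assume "\<not> r x \<le> r w"
    then obtain z where "z \<in> {x<..<w}" "r z < r x"
      using derivative_sign.neg_left[OF derivative_sign_shift, of w "r x" x] x assms by auto
    then show False
      using mono_onD[OF mono, of x z] x by auto
  qed
  fix x y assume xy: "x \<in> {v..w} \<inter> {0<..<1}" "y \<in> {v..w} \<inter> {0<..<1}" "x \<le> y"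
  show "r x \<le> r y"
  proof (cases "x = y")
    case False
    \<comment> \<open>The points \<open>x\<close> and \<open>y\<close> may be the ends
      \<open>v\<close> and \<open>w\<close>, where monotonicity is not given; \<open>m\<close> is
      strictly inside.\<close>
    define m where "m = (x + y) / 2"
    have m: "x < m" "m < y" "v < m" "m < w"
      using xy False by (auto simp: m_def)
    have "r x \<le> r m"
      using left[of m] mono_onD[OF mono, of x m] m xy by (cases "x = v") auto
    also have "r m \<le> r y"
      using right[of m] mono_onD[OF mono, of m y] m xy by (cases "y = w") auto
    finally show ?thesis .
  qed simp
qed

text \<open>A Cauchy mean value argument: B y - B x is at most r y * (A y - A x).\<close>

lemma dev_increment:
  assumes "0 \<le> v" "w \<le> 1" "mono_on {v<..<w} r"
    and x: "x \<in> {v..w} \<inter> {0<..<1}" and y: "y \<in> {v..w} \<inter> {0<..<1}" and "x \<le> y"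
  shows "A x * (r y - r x) \<le> dev y - dev x"
proof (cases "x = y")
  case False
  with \<open>x \<le> y\<close> have "x < y"
    by simp
  have "B y - B x \<le> r y * (A y - A x)"
  proof (rule ccontr)
    assume "\<not> ?thesis"
    then have "B x - r y * A x < B y - r y * A y"
      by (simp add: algebra_simps)
    then have "\<exists>z\<in>{x<..<y}. 0 < r z - r y"
      using derivative_sign.pos_between[OF derivative_sign_shift, of x y "r y"] x y \<open>x < y\<close> by simp
    then obtain z where z: "z \<in> {x<..<y}" "r y < r z"
      by auto
    have "r z \<le> r y"
      using z(1) x y by (intro mono_onD[OF r_mono_on_closed[OF assms(1-3)]]) auto
    then show False
      using z(2) by simp
  qed
  then show ?thesis
    by (simp add: dev_def algebra_simps)
qed simp

text \<open>Including the ends that lie in \<open>{0<..<1}\<close> matters, because the mode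
  conditions evaluate \<open>dev\<close> at the points \<open>p i\<close>.\<close>

lemma dev_mono_on:
  assumes "0 \<le> v" "w \<le> 1" "mono_on {v<..<w} r"
  shows "mono_on ({v..w} \<inter> {0<..<1}) dev"
proof (intro mono_onI)
  fix x y assume xy: "x \<in> {v..w} \<inter> {0<..<1}" "y \<in> {v..w} \<inter> {0<..<1}" "x \<le> y"
  then have "0 \<le> A x * (r y - r x)"
    using mono_onD[OF r_mono_on_closed[OF assms], of x y] A_pos[of x] by simp
  then show "dev x \<le> dev y"
    using dev_increment[OF assms xy] by simp
qed

lemma dev_antimono_on:
  assumes "0 \<le> v" "w \<le> 1" "antimono_on {v<..<w} r"
  shows "antimono_on ({v..w} \<inter> {0<..<1}) dev"
proof -
  have "mono_on {v<..<w} (\<lambda>x. - r x)"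
    using assms(3) by (auto simp: monotone_on_def)
  from quotient_pair.dev_mono_on[OF uminus assms(1,2) this] show ?thesis
    by (simp add: dev_uminus monotone_on_def)
qed

text \<open>For increasing \<open>r\<close>, the increment of \<open>dev\<close> bounds
  \<open>A x * (r y - r x)\<close> from above, and monotonicity bounds it below by 0. The decreasing
  case follows by negating \<open>B\<close> and \<open>r\<close>.\<close>

lemma r_eq_if_dev_eq:
  assumes "0 \<le> v" "w \<le> 1" "mono_on {v<..<w} r \<or> antimono_on {v<..<w} r"
    and xy: "x \<in> {v..w} \<inter> {0<..<1}" "y \<in> {v..w} \<inter> {0<..<1}" "x \<le> y" and "dev x = dev y"
  shows "r x = r y"
proof -
  have "0 < A x"
    using A_pos xy by auto
  from assms(3) show ?thesis
  proof
    assume mono: "mono_on {v<..<w} r"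
    have "r x \<le> r y"
      by (rule mono_onD[OF r_mono_on_closed[OF assms(1,2) mono] xy])
    moreover have "A x * (r y - r x) \<le> 0"
      using dev_increment[OF assms(1,2) mono xy] \<open>dev x = dev y\<close> by simp
    ultimately show ?thesis
      using \<open>0 < A x\<close> by (simp add: mult_le_0_iff)
  next
    assume "antimono_on {v<..<w} r"
    then have mono: "mono_on {v<..<w} (\<lambda>x. - r x)"
      by (auto simp: monotone_on_def)
    have "- r x \<le> - r y"
      by (rule mono_onD[OF quotient_pair.r_mono_on_closed[OF uminus assms(1,2) mono] xy])
    moreover have "A x * (r x - r y) \<le> 0"
      using quotient_pair.dev_increment[OF uminus assms(1,2) mono xy] \<open>dev x = dev y\<close>
      by (simp add: dev_uminus)
    ultimately show ?thesis
      using \<open>0 < A x\<close> by (simp add: mult_le_0_iff)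
  qed
qed

end

section \<open>Locating and counting the modes of the quotient\<close>

locale alternating_quotient_pair = quotient_pair +
  fixes n :: nat and p :: "nat \<Rightarrow> real"
  assumes n_pos: "1 \<le> n" and alternating: "alternating_modes r n p"
begin

sublocale quotient: derivative_sign 0 1 "\<lambda>x. B x / A x" "\<lambda>x. a x / (A x)\<^sup>2" dev
  by (rule derivative_sign_quotient)

abbreviation "h \<equiv> \<lambda>x. B x / A x"

lemma p_ends: "p 0 = 0" "p (Suc n) = 1"
  using alternating by (simp_all add: alternating_modes_def)

lemma p_less: "i < j \<Longrightarrow> j \<le> Suc n \<Longrightarrow> p i < p j"
  using alternating unfolding alternating_modes_def strict_mono_on_def
  by (metis atLeastAtMost_iff le0 less_imp_le order_trans)

lemma p_bounds: "i \<le> Suc n \<Longrightarrow> 0 \<le> p i" "i \<le> Suc n \<Longrightarrow> p i \<le> 1"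
  using p_less[of 0 i] p_less[of i "Suc n"] p_ends
  by (cases "i = 0"; cases "i = Suc n"; simp)+

lemma p_inner: "i \<in> {1..n} \<Longrightarrow> p i \<in> {0<..<1}"
  using p_less[of 0 i] p_less[of i "Suc n"] p_ends by auto

lemma r_monotone: "i \<le> n \<Longrightarrow> even i \<Longrightarrow> mono_on {p i<..<p (Suc i)} r"
  "i \<le> n \<Longrightarrow> odd i \<Longrightarrow> antimono_on {p i<..<p (Suc i)} r"
  using alternating unfolding alternating_modes_def by auto

lemma dev_mono: "i \<le> n \<Longrightarrow> even i \<Longrightarrow> mono_on ({p i..p (Suc i)} \<inter> {0<..<1}) dev"
  by (intro dev_mono_on r_monotone p_bounds) auto

lemma dev_antimono: "i \<le> n \<Longrightarrow> odd i \<Longrightarrow> antimono_on ({p i..p (Suc i)} \<inter> {0<..<1}) dev"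
  by (intro dev_antimono_on r_monotone p_bounds) auto

lemma dev_monotone:
  assumes "i \<le> n"
  shows "mono_on {p i<..<p (Suc i)} dev \<or> antimono_on {p i<..<p (Suc i)} dev"
proof -
  have "{p i<..<p (Suc i)} \<subseteq> {p i..p (Suc i)} \<inter> {0<..<1}"
    using p_bounds[of i] p_bounds[of "Suc i"] assms by auto
  then show ?thesis
    using dev_mono[OF assms] dev_antimono[OF assms] by (meson monotone_on_subset)
qed

lemma has_mode_iff:
  assumes "i \<le> n"
  shows "has_mode_within {0<..<1} h {p i<..<p (Suc i)} \<longleftrightarrow>
    (\<exists>x\<in>{p i<..<p (Suc i)}. dev x < 0) \<and> (\<exists>y\<in>{p i<..<p (Suc i)}. 0 < dev y)"
  using assms by (intro quotient.has_mode_within_iff p_bounds dev_monotone) auto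

text \<open>The index range makes both ends locations of modes of \<open>r\<close>; a common mode
  would contradict injectivity of the enumeration \<open>S\<close>.\<close>

lemma dev_nonzero_between:
  assumes "i \<in> {1..<n}"
  shows "\<exists>x\<in>{p i..p (Suc i)}. dev x \<noteq> 0"
proof (rule ccontr)
  assume "\<not> ?thesis"
  then have zero: "dev x = 0" if "x \<in> {p i..p (Suc i)}" for x
    using that by blast
  obtain S where S: "bij_betw S {1..n} (modes_on {0<..<1} r)" "\<And>i. i \<in> {1..n} \<Longrightarrow> p i \<in> S i"
    using alternating unfolding alternating_modes_def by blast
  have i: "i \<in> {1..n}" "Suc i \<in> {1..n}" "p i < p (Suc i)"
    using assms p_less[of i "Suc i"] by auto
  have modes: "S i \<in> modes_on {0<..<1} r" "S (Suc i) \<in> modes_on {0<..<1} r"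
    using S(1) i by (auto simp: bij_betw_def)
  have "{p i..p (Suc i)} \<subseteq> S i"
  proof (rule flat_interval_subset_mode[OF modes(1) S(2)[OF i(1)]])
    fix y assume y: "y \<in> {p i..p (Suc i)}"
    have "r (p i) = r y"
      using p_inner[OF i(1)] p_inner[OF i(2)] y i zero[of y] zero[of "p i"] p_bounds[of i]
        p_bounds[of "Suc i"] r_monotone[of i]
      by (intro r_eq_if_dev_eq[of "p i" "p (Suc i)"]) auto
    then show "r y = r (p i)" ..
  qed (use i in auto)
  then have "p (Suc i) \<in> S i"
    using i by auto
  then have "S i = S (Suc i)"
    by (intro modes_disjoint[OF modes]) (auto intro: S(2) i)
  then show False
    using S(1) i(1,2) unfolding bij_betw_def inj_on_def by (metis n_not_Suc_n)
qed

text \<open>At \<open>p i\<close>, \<open>dev\<close> turns from increasing to decreasing or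
  conversely. If it vanishes there, it has the same weak sign on both sides, whereas a mode requires
  a change of sign.\<close>

lemma mode_avoids:
  assumes S: "S \<in> modes_on {0<..<1} h" and i: "i \<in> {1..n}"
  shows "p i \<notin> S"
proof
  assume "p i \<in> S"
  obtain b c s where bc: "S = {b..c}" "b \<le> c" "0 < b" "c < 1" "s = 1 \<or> s = (- 1 :: real)"
    and zero: "\<forall>x\<in>{b..c}. dev x = 0"
    and left: "\<forall>x\<in>{0..<b}. \<exists>y\<in>{x<..<b}. 0 < s * dev y"
    and right: "\<forall>x\<in>{c<..1}. \<exists>y\<in>{c<..<x}. s * dev y < 0"
    by (rule quotient.mode_crossing[OF S])
  have pi: "b \<le> p i" "p i \<le> c" "p i \<in> {0<..<1}"
    using \<open>p i \<in> S\<close> bc p_inner[OF i] by auto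
  \<comment> \<open>\<open>j\<close> indexes the interval that ends at \<open>p i\<close>.\<close>
  obtain j where j: "i = Suc j" "j \<le> n"
    using i by (cases i) auto
  \<comment> \<open>Otherwise \<open>dev\<close> would vanish on all of
    \<open>{p i..p (Suc i)}\<close>, or \<open>c\<close> would reach 1 when \<open>i = n\<close>.
    The left side is analogous.\<close>
  have "c < p (Suc i)"
  proof (rule ccontr)
    assume *: "\<not> c < p (Suc i)"
    then have "i \<noteq> n"
      using p_ends bc by auto
    then show False
      using dev_nonzero_between[of i] i * zero pi by force
  qed
  moreover have "p j < b"
  proof (rule ccontr)
    assume *: "\<not> p j < b"
    then have "j \<noteq> 0"
      using p_ends bc by (metis)
    then show False
      using dev_nonzero_between[of j] i j * zero pi by force
  qed
  ultimately have bounds: "0 \<le> p j" "p j < b" "c < p (Suc i)" "p (Suc i) \<le> 1"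
    using p_bounds[of j] p_bounds[of "Suc i"] i j by auto
  obtain y where y: "p j < y" "y < b" "0 < s * dev y"
    using bspec[OF left, of "p j"] bounds by auto
  obtain z where z: "c < z" "z < p (Suc i)" "s * dev z < 0"
    using bspec[OF right, of "p (Suc i)"] bounds by auto
  have mem: "y \<in> {p j..p (Suc j)} \<inter> {0<..<1}" "p i \<in> {p j..p (Suc j)} \<inter> {0<..<1}"
    "z \<in> {p i..p (Suc i)} \<inter> {0<..<1}" "p i \<in> {p i..p (Suc i)} \<inter> {0<..<1}" "y \<le> p i" "p i \<le> z"
    using y z pi bounds j bc by auto
  have "dev (p i) = 0"
    using zero pi by auto
  moreover have "i \<le> n"
    using i by simp
  ultimately have "0 \<le> dev y * dev z"
  proof (cases "even i")
    case True
    then have "dev y \<ge> dev (p i)" "dev z \<ge> dev (p i)"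
      using dev_antimono[OF j(2)] dev_mono[OF \<open>i \<le> n\<close>] mem j(1) unfolding monotone_on_def by auto
    then show ?thesis
      using \<open>dev (p i) = 0\<close> by simp
  next
    case False
    then have "dev y \<le> dev (p i)" "dev z \<le> dev (p i)"
      using dev_mono[OF j(2)] dev_antimono[OF \<open>i \<le> n\<close>] mem j(1) unfolding monotone_on_def by auto
    then show ?thesis
      using \<open>dev (p i) = 0\<close> by (simp add: mult_nonpos_nonpos)
  qed
  then show False
    using y z bc(5) by (auto simp: zero_le_mult_iff)
qed

text \<open>There is one candidate for each of the \<open>n + 1\<close> intervals, which gives both
  finiteness and the bound.\<close>

lemma modes_subset:
  "modes_on {0<..<1} h \<subseteq> (\<lambda>i. {x \<in> {p i<..<p (Suc i)}. dev x = 0}) ` {..n}"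
proof
  fix S assume S: "S \<in> modes_on {0<..<1} h"
  obtain b c s where bc: "S = {b..c}" "b \<le> c" "0 < b" "c < 1" "s = 1 \<or> s = (- 1 :: real)"
    and "\<forall>x\<in>{b..c}. dev x = 0" "\<forall>x\<in>{0..<b}. \<exists>y\<in>{x<..<b}. 0 < s * dev y"
    "\<forall>x\<in>{c<..1}. \<exists>y\<in>{c<..<x}. s * dev y < 0"
    by (rule quotient.mode_crossing[OF S])
  \<comment> \<open>The last point before the mode; it exists since \<open>p 0 = 0 < b\<close>. The
    next point is at least \<open>b\<close> and avoids the mode, so it lies beyond
    \<open>c\<close>.\<close>
  define i where "i = (GREATEST i. i \<le> n \<and> p i < b)"
  have i: "i \<le> n \<and> p i < b"
    unfolding i_def by (rule GreatestI_nat[where k = 0 and b = n]) (use p_ends bc in auto)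
  have "c < p (Suc i)"
  proof (cases "i = n")
    case False
    then have "\<not> p (Suc i) < b"
      using Greatest_le_nat[of "\<lambda>i. i \<le> n \<and> p i < b" "Suc i" n] i by (auto simp: i_def[symmetric])
    then show ?thesis
      using mode_avoids[OF S, of "Suc i"] i False bc by auto
  qed (use p_ends bc in auto)
  then have "S \<subseteq> {p i<..<p (Suc i)}"
    using i bc by auto
  then have "S = {x \<in> {p i<..<p (Suc i)}. dev x = 0}"
    using i p_bounds[of i] p_bounds[of "Suc i"]
    by (intro quotient.mode_eq_zero_set[OF S] dev_monotone) auto
  then show "S \<in> (\<lambda>i. {x \<in> {p i<..<p (Suc i)}. dev x = 0}) ` {..n}"
    using i by blast
qed

lemma finite_modes: "finite (modes_on {0<..<1} h)"
  using modes_subset by (rule finite_subset) simp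

lemma card_modes_le: "card (modes_on {0<..<1} h) \<le> n + 1"
  using surj_card_le[OF _ modes_subset] by simp

text \<open>For even \<open>i\<close>, \<open>dev\<close> is smallest at the left end, so a negative
  value inside is inherited by \<open>p i\<close>. Conversely, a negative value at
  \<open>p i\<close> spreads inwards by \<open>neg_right\<close>. The next three lemmas treat the
  other parity and the other end likewise.\<close>

lemma dev_neg_right_iff:
  assumes "i \<in> {1..n}" "even i"
  shows "(\<exists>x\<in>{p i<..<p (Suc i)}. dev x < 0) \<longleftrightarrow> dev (p i) < 0"
proof
  assume "dev (p i) < 0"
  then show "\<exists>x\<in>{p i<..<p (Suc i)}. dev x < 0"
    using quotient.neg_right[OF p_inner[OF assms(1)], of "p (Suc i)"] p_less[of i "Suc i"] assms by auto
next
  assume "\<exists>x\<in>{p i<..<p (Suc i)}. dev x < 0"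
  then obtain x where x: "x \<in> {p i<..<p (Suc i)}" "dev x < 0" ..
  then have "dev (p i) \<le> dev x"
    using p_inner[OF assms(1)] p_bounds[of "Suc i"] assms
    by (intro mono_onD[OF dev_mono[of i]]) auto
  then show "dev (p i) < 0"
    using x by simp
qed

lemma dev_pos_right_iff:
  assumes "i \<in> {1..n}" "odd i"
  shows "(\<exists>x\<in>{p i<..<p (Suc i)}. 0 < dev x) \<longleftrightarrow> 0 < dev (p i)"
proof
  assume "0 < dev (p i)"
  then show "\<exists>x\<in>{p i<..<p (Suc i)}. 0 < dev x"
    using quotient.pos_right[OF p_inner[OF assms(1)], of "p (Suc i)"] p_less[of i "Suc i"] assms by auto
next
  assume "\<exists>x\<in>{p i<..<p (Suc i)}. 0 < dev x"
  then obtain x where x: "x \<in> {p i<..<p (Suc i)}" "0 < dev x" ..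
  then have "dev x \<le> dev (p i)"
    using p_inner[OF assms(1)] p_bounds[of "Suc i"] assms
    by (intro monotone_onD[OF dev_antimono[of i]]) auto
  then show "0 < dev (p i)"
    using x by simp
qed

lemma dev_pos_left_iff:
  assumes "i < n" "even i"
  shows "(\<exists>x\<in>{p i<..<p (Suc i)}. 0 < dev x) \<longleftrightarrow> 0 < dev (p (Suc i))"
proof
  assume "0 < dev (p (Suc i))"
  then show "\<exists>x\<in>{p i<..<p (Suc i)}. 0 < dev x"
    using quotient.pos_left[OF p_inner, of "Suc i" "p i"] p_less[of i "Suc i"] assms by auto
next
  assume "\<exists>x\<in>{p i<..<p (Suc i)}. 0 < dev x"
  then obtain x where x: "x \<in> {p i<..<p (Suc i)}" "0 < dev x" ..
  then have "dev x \<le> dev (p (Suc i))"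
    using p_inner[of "Suc i"] p_bounds[of i] assms
    by (intro mono_onD[OF dev_mono[of i]]) auto
  then show "0 < dev (p (Suc i))"
    using x by simp
qed

lemma dev_neg_left_iff:
  assumes "i < n" "odd i"
  shows "(\<exists>x\<in>{p i<..<p (Suc i)}. dev x < 0) \<longleftrightarrow> dev (p (Suc i)) < 0"
proof
  assume "dev (p (Suc i)) < 0"
  then show "\<exists>x\<in>{p i<..<p (Suc i)}. dev x < 0"
    using quotient.neg_left[OF p_inner, of "Suc i" "p i"] p_less[of i "Suc i"] assms by auto
next
  assume "\<exists>x\<in>{p i<..<p (Suc i)}. dev x < 0"
  then obtain x where x: "x \<in> {p i<..<p (Suc i)}" "dev x < 0" ..
  then have "dev (p (Suc i)) \<le> dev x"
    using p_inner[of "Suc i"] p_bounds[of i] assms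
    by (intro monotone_onD[OF dev_antimono[of i]]) auto
  then show "dev (p (Suc i)) < 0"
    using x by simp
qed

lemma mode_between_iff:
  assumes i: "i \<in> {1..<n}"
  shows "has_mode_within {0<..<1} h {p i<..<p (Suc i)} \<longleftrightarrow> dev (p i) * dev (p (Suc i)) < 0"
proof -
  \<comment> \<open>\<open>le\<close> and \<open>ge\<close> exclude the sign pattern that runs
    against the monotonicity, so a negative product leaves just the pattern that produces a
    mode.\<close>
  have le: "dev (p i) \<le> dev (p (Suc i))" if "even i"
    using p_inner[of i] p_inner[of "Suc i"] p_less[of i "Suc i"] i that
    by (intro mono_onD[OF dev_mono[of i]]) auto
  have ge: "dev (p i) \<ge> dev (p (Suc i))" if "odd i"
    using p_inner[of i] p_inner[of "Suc i"] p_less[of i "Suc i"] i that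
    by (intro monotone_onD[OF dev_antimono[of i]]) auto
  have "has_mode_within {0<..<1} h {p i<..<p (Suc i)} \<longleftrightarrow>
    (\<exists>x\<in>{p i<..<p (Suc i)}. dev x < 0) \<and> (\<exists>y\<in>{p i<..<p (Suc i)}. 0 < dev y)"
    using i by (intro has_mode_iff) auto
  also have "\<dots> \<longleftrightarrow> dev (p i) * dev (p (Suc i)) < 0"
    using dev_neg_right_iff[of i] dev_pos_right_iff[of i] dev_pos_left_iff[of i]
      dev_neg_left_iff[of i] i le ge
    by (cases "even i") (auto simp: mult_less_0_iff)
  finally show ?thesis .
qed

text \<open>At 0 the limit takes over the role of an end point value. The interval has index 0,
  which is even, so \<open>dev\<close> increases on it.\<close>

lemma mode_first_iff:
  "\<exists>L :: ereal. ((\<lambda>t. ereal (dev t)) \<longlongrightarrow> L) (at_right 0) \<and>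
    (has_mode_within {0<..<1} h {0<..<p 1} \<longleftrightarrow> L * ereal (dev (p 1)) < 0)"
proof -
  have "p 1 \<in> {0<..<1}"
    using p_inner[of 1] n_pos by simp
  then have "mono_on {0<..p 1} dev"
    using dev_mono[of 0] p_ends by (auto intro: monotone_on_subset)
  from mono_at_right_limit[OF _ this] \<open>p 1 \<in> {0<..<1}\<close> obtain L :: ereal where
    "((\<lambda>t. ereal (dev t)) \<longlongrightarrow> L) (at_right 0)"
    "L * ereal (dev (p 1)) < 0 \<longleftrightarrow> 0 < dev (p 1) \<and> (\<exists>x\<in>{0<..<p 1}. dev x < 0)"
    by auto
  moreover have "has_mode_within {0<..<1} h {0<..<p 1} \<longleftrightarrow>
    (\<exists>x\<in>{0<..<p 1}. dev x < 0) \<and> (\<exists>y\<in>{0<..<p 1}. 0 < dev y)"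
    using has_mode_iff[of 0] p_ends by simp
  moreover have "(\<exists>y\<in>{0<..<p 1}. 0 < dev y) \<longleftrightarrow> 0 < dev (p 1)"
    using dev_pos_left_iff[of 0] n_pos p_ends by simp
  ultimately show ?thesis
    by blast
qed

lemma mode_last_iff:
  "\<exists>L :: ereal. ((\<lambda>t. ereal (dev t)) \<longlongrightarrow> L) (at_left 1) \<and>
    (has_mode_within {0<..<1} h {p n<..<1} \<longleftrightarrow> L * ereal (dev (p n)) < 0)"
proof -
  have pn: "p n \<in> {0<..<1}" "n \<in> {1..n}"
    using p_inner[of n] n_pos by simp_all
  have mode: "has_mode_within {0<..<1} h {p n<..<1} \<longleftrightarrow>
    (\<exists>x\<in>{p n<..<1}. dev x < 0) \<and> (\<exists>y\<in>{p n<..<1}. 0 < dev y)"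
    using has_mode_iff[of n] p_ends by simp
  show ?thesis
  proof (cases "even n")
    case True
    then have "mono_on {p n..<1} dev"
      using dev_mono[of n] p_ends pn by (auto intro: monotone_on_subset)
    from mono_at_left_limit[OF _ this] pn obtain L :: ereal where
      "((\<lambda>t. ereal (dev t)) \<longlongrightarrow> L) (at_left 1)"
      "L * ereal (dev (p n)) < 0 \<longleftrightarrow> dev (p n) < 0 \<and> (\<exists>x\<in>{p n<..<1}. 0 < dev x)"
      by auto
    moreover have "(\<exists>x\<in>{p n<..<1}. dev x < 0) \<longleftrightarrow> dev (p n) < 0"
      using dev_neg_right_iff[OF pn(2) True] p_ends by simp
    ultimately show ?thesis
      using mode by blast
  next
    case False
    then have "antimono_on {p n..<1} dev"
      using dev_antimono[of n] p_ends pn by (auto intro: monotone_on_subset)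
    \<comment> \<open>Negation reduces the decreasing case to the limit lemma; both factors change
      sign, so the product stays the same.\<close>
    then have "mono_on {p n..<1} (\<lambda>x. - dev x)"
      by (simp add: monotone_on_def)
    from mono_at_left_limit[OF _ this] pn obtain L :: ereal where
      L: "((\<lambda>t. ereal (- dev t)) \<longlongrightarrow> L) (at_left 1)"
      and iff: "L * ereal (- dev (p n)) < 0 \<longleftrightarrow> 0 < dev (p n) \<and> (\<exists>x\<in>{p n<..<1}. dev x < 0)"
      by auto
    have "((\<lambda>t. ereal (dev t)) \<longlongrightarrow> - L) (at_left 1)"
      using tendsto_uminus_ereal[OF L] by simp
    moreover have "- L * ereal (dev (p n)) = L * ereal (- dev (p n))"
      by (cases L) auto
    moreover have "(\<exists>x\<in>{p n<..<1}. 0 < dev x) \<longleftrightarrow> 0 < dev (p n)"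
      using dev_pos_right_iff[OF pn(2) False] p_ends by simp
    ultimately show ?thesis
      using mode iff by (intro exI[of _ "- L"]) auto
  qed
qed

end

section \<open>Positivity of quantile functions\<close>

context quantile_rv
begin

lemma quantile_nonneg:
  assumes "p \<in> {0<..<1}"
  shows "0 \<le> quantile M X p"
proof -
  have X: "random_variable borel X"
    using density by (simp add: distributed_def)
  then interpret D: real_distribution "distr M borel X"
    by (rule real_distribution_distr)
  have "\<forall>\<^sub>F x in at_top. p < cdf (distr M borel X) x"
    using assms by (intro order_tendstoD(1)[OF D.cdf_lim_at_top_prob]) auto
  then obtain x where "p < cdf (distr M borel X) x"
    by (auto simp: eventually_at_top_linorder)
  \<comment> \<open>Nonemptiness is needed because the real infimum is a greatest lower bound just
    for nonempty sets bounded below.\<close>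
  then have "{x. p \<le> cdf (distr M borel X) x} \<noteq> {}"
    by (auto intro: less_imp_le)
  moreover have "0 \<le> x" if "p \<le> cdf (distr M borel X) x" for x
  proof (rule ccontr)
    assume "\<not> 0 \<le> x"
    have "cdf (distr M borel X) x = prob (X -` {..x} \<inter> space M)"
      using X by (simp add: cdf_def measure_distr)
    also have "\<dots> = 0"
      using nonneg \<open>\<not> 0 \<le> x\<close> X by (subst prob_eq_0) (auto elim!: eventually_mono)
    finally show False
      using that assms by simp
  qed
  ultimately show ?thesis
    unfolding quantile_def by (intro cInf_greatest) auto
qed

text \<open>The positive derivative makes the quantile function strictly increasing, so its value
  exceeds the nonnegative one at \<open>p / 2\<close>. This permits dividing by
  \<open>Finv\<close>.\<close>

lemma quantile_pos:
  assumes "p \<in> {0<..<1}"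
  shows "0 < quantile M X p"
proof -
  have "quantile M X (p / 2) < quantile M X p"
  proof (rule DERIV_pos_imp_increasing[where f = "quantile M X"])
    show "\<exists>D. (quantile M X has_real_derivative D) (at t) \<and> 0 < D" if "p / 2 \<le> t" "t \<le> p" for t
      using that assms quantile_deriv[of t] density_pos[of t] by auto
  qed (use assms in auto)
  moreover have "0 \<le> quantile M X (p / 2)"
    using assms by (intro quantile_nonneg) auto
  ultimately show ?thesis
    by simp
qed

end

theorem theorem2p1:
  fixes M :: "'a measure" and N :: "'b measure"
    and X :: "'a \<Rightarrow> real" and Y :: "'b \<Rightarrow> real"
    and f g :: "real \<Rightarrow> real" and l\<^sub>X u\<^sub>X l\<^sub>Y u\<^sub>Y :: ereal
    and n :: nat and p :: "nat \<Rightarrow> real"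
    and Finv Ginv \<delta> h :: "real \<Rightarrow> real"
  assumes "quantile_rv M X f l\<^sub>X u\<^sub>X"
    and "quantile_rv N Y g l\<^sub>Y u\<^sub>Y"
    and "Finv = quantile M X"
    and "Ginv = quantile N Y"
    and "1 \<le> n"
    and "alternating_modes (density_quantile_ratio Finv f Ginv g) n p"
    and "\<delta> = delta Finv f Ginv g"
    and "h = (\<lambda>t. Ginv t / Finv t)"
  shows "finite (modes_on {0<..<1} h) \<and> card (modes_on {0<..<1} h) \<le> n + 1
    \<and> (\<exists>L\<^sub>0 :: ereal. ((\<lambda>t. ereal (\<delta> t)) \<longlongrightarrow> L\<^sub>0) (at_right 0) \<and>
         (has_mode_within {0<..<1} h {0<..<p 1} \<longleftrightarrow> L\<^sub>0 * ereal (\<delta> (p 1)) < 0))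
    \<and> (\<forall>i\<in>{1..<n}. has_mode_within {0<..<1} h {p i<..<p (i + 1)} \<longleftrightarrow> \<delta> (p i) * \<delta> (p (i + 1)) < 0)
    \<and> (\<exists>L\<^sub>1 :: ereal. ((\<lambda>t. ereal (\<delta> t)) \<longlongrightarrow> L\<^sub>1) (at_left 1) \<and>
         (has_mode_within {0<..<1} h {p n<..<1} \<longleftrightarrow> L\<^sub>1 * ereal (\<delta> (p n)) < 0))"
proof -
  interpret X: quantile_rv M X f l\<^sub>X u\<^sub>X by fact
  interpret Y: quantile_rv N Y g l\<^sub>Y u\<^sub>Y by fact
  let ?r = "density_quantile_ratio Finv f Ginv g"
  interpret alternating_quotient_pair Finv Ginv "\<lambda>t. 1 / f (Finv t)" ?r n p
  proof
    fix t :: real assume t: "t \<in> {0<..<1}"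
    show "0 < Finv t" "(Finv has_real_derivative 1 / f (Finv t)) (at t)" "0 < 1 / f (Finv t)"
      using t X.quantile_pos X.quantile_deriv X.density_pos assms(3) by auto
    \<comment> \<open>The positive factor \<open>f (Finv t)\<close> cancels and leaves
      \<open>1 / g (Ginv t)\<close>.\<close>
    show "(Ginv has_real_derivative ?r t * (1 / f (Finv t))) (at t)"
      using t Y.quantile_deriv[OF t] X.density_pos[OF t] assms(3,4)
      by (simp add: density_quantile_ratio_def)
  qed fact+
  have "\<delta> = dev"
    unfolding assms(7) by (intro ext) (simp add: delta_def dev_def)
  then show ?thesis
    using finite_modes card_modes_le mode_first_iff mode_between_iff mode_last_iff
    unfolding assms(8) by simp
qed

end
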